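(* Let $\{p_k\}_{k\ge0}$ be the antisymmetric orthogonal polynomials on the Sierpinski gasket $SG$ obtained from $\{P_{k3}\}_{k\ge 0}$ by the monic Gram–Schmidt process, let $d_k=\|p_k\|_{L^2}^{-1}$, and let $Q_k=d_kp_k$ be the corresponding orthonormal polynomials, so $Q_0=d_0P_{03}$; put $Q_{-1}:=0$. Let $\tilde f_0:=0$ and for $k\ge0$ $$\tilde f_{k+1}(x):=-\int_{SG}G(x,y)\,Q_k(y)\,d\mu(y).$$ Then for each $k\ge0$ $$\sqrt{c_{k+1}}\,Q_{k+1}(x)=\tilde f_{k+1}(x)-b_k\,Q_k(x)-\sqrt{c_k}\,Q_{k-1}(x)\qquad(x\in SG),$$ where $b_k=d_k^2\langle f_{k+1},p_k\rangle$ with $f_{k+1}(x)=-\int_{SG}G(x,y)p_k(y)\,d\mu(y)$, and $c_k=d_{k-1}^2/d_k^2$ for $k\ge1$ (for $k=0$ the last term is $0$).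
   Context: Sierpinski gasket: let $q_0,q_1,q_2$ be the vertices of an equilateral triangle in $\mathbb{R}^2$, $F_i(x)=\tfrac12(x-q_i)+q_i$, and $SG$ the nonempty compact set with $SG=\bigcup_{i=0}^2F_i(SG)$. For a word $w=(w_1,\dots,w_m)$, $F_w=F_{w_1}\circ\cdots\circ F_{w_m}$ and $F_w(SG)$ is a cell of level $m$. $V_0=\{q_0,q_1,q_2\}$ is the boundary, $V_m=\bigcup_iF_iV_{m-1}$, $V_*=\bigcup_mV_m$; for distinct $x,y\in V_m$, $x\sim_m y$ iff $x,y$ lie in a common cell of level $m$. $\mu$ is the probability measure on $SG$ giving mass $3^{-m}$ to each cell of level $m$; all functions are real-valued, $\langle f,g\rangle=\int_{SG}fg\,d\mu$ and $\|f\|_{L^2}^2=\langle f,f\rangle$. Laplacian: $\Delta u(x)=\lim_{m\to\infty}\tfrac32 5^m\sum_{y\sim_m x}(u(y)-u(x))$ for $x\in V_*\setminus V_0$; a continuous $u$ is in the domain with $\Delta u=f$ ($f$ continuous on $SG$) if these limits converge uniformly to $f$ on $V_*\setminus V_0$. Derivatives at $q_0$: $\partial_nu(q_0)=\lim_m(5/3)^m\big(2u(q_0)-u(F_0^mq_1)-u(F_0^mq_2)\big)$ and $\partial_Tu(q_0)=\lim_m5^m\big(u(F_0^mq_1)-u(F_0^mq_2)\big)$. Green's function: $G(x,y)$ is the continuous symmetric kernel on $SG\times SG$ such that for every continuous $f$ the unique solution of $-\Delta u=f$, $u|_{V_0}=0$ is $u(x)=\int_{SG}G(x,y)f(y)\,d\mu(y)$.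 The antisymmetric monomial $P_{j3}$ ($j\ge0$) is the unique function with $\Delta^{j+1}P_{j3}=0$ and, for $0\le m\le j$, $\Delta^mP_{j3}(q_0)=0$, $\partial_n\Delta^mP_{j3}(q_0)=0$, $\partial_T\Delta^mP_{j3}(q_0)=\delta_{m,j}$. Gram–Schmidt: $p_0=P_{03}$ and $p_j=P_{j3}-\sum_{l=0}^{j-1}d_l^2\langle P_{j3},p_l\rangle p_l$ for $j\ge1$, where $d_l>0$ and $d_l^{-2}=\|p_l\|_{L^2}^2$. *)

theory Defs
  imports "HOL-Probability.Probability"
begin

section \<open>The Sierpinski gasket\<close>

text \<open>
  The three vertices are a family \<open>q :: 3 \<Rightarrow> real^2\<close>; the elements of the numeral type \<open>3\<close> are
  \<open>0\<close>, \<open>1\<close>, \<open>2\<close> (arithmetic is modulo 3).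
\<close>

definition equilateral :: "(3 \<Rightarrow> real^2) \<Rightarrow> bool" where
  "equilateral q \<longleftrightarrow>
     q 0 \<noteq> q 1 \<and> dist (q 0) (q 1) = dist (q 1) (q 2) \<and> dist (q 1) (q 2) = dist (q 2) (q 0)"

definition contr :: "(3 \<Rightarrow> real^2) \<Rightarrow> 3 \<Rightarrow> real^2 \<Rightarrow> real^2" where
  "contr q i x = (1/2) *\<^sub>R (x - q i) + q i"

primrec word_map :: "(3 \<Rightarrow> real^2) \<Rightarrow> 3 list \<Rightarrow> real^2 \<Rightarrow> real^2" where
  "word_map q [] = id"
| "word_map q (i # w) = contr q i \<circ> word_map q w"

text \<open>Well-definedness of this description is lemma \<open>gasket_unique_existence\<close> below.\<close>

definition gasket :: "(3 \<Rightarrow> real^2) \<Rightarrow> (real^2) set" where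
  "gasket q = (THE K. compact K \<and> K \<noteq> {} \<and> K = (\<Union>i. contr q i ` K))"

primrec vertices :: "(3 \<Rightarrow> real^2) \<Rightarrow> nat \<Rightarrow> (real^2) set" where
  "vertices q 0 = range q"
| "vertices q (Suc m) = (\<Union>i. contr q i ` vertices q m)"

definition cells :: "(3 \<Rightarrow> real^2) \<Rightarrow> nat \<Rightarrow> (real^2) set set" where
  "cells q m = {word_map q w ` gasket q | w. length w = m}"

definition neighbours :: "(3 \<Rightarrow> real^2) \<Rightarrow> nat \<Rightarrow> real^2 \<Rightarrow> (real^2) set" where
  "neighbours q m x =
     {y \<in> vertices q m. y \<noteq> x \<and> x \<in> vertices q m \<and> (\<exists>C \<in> cells q m. x \<in> C \<and> y \<in> C)}"

definition standard_measure :: "(3 \<Rightarrow> real^2) \<Rightarrow> (real^2) measure \<Rightarrow> bool" where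
  "standard_measure q \<mu> \<longleftrightarrow>
     prob_space \<mu> \<and> sets \<mu> = sets (restrict_space borel (gasket q)) \<and>
     (\<forall>m. \<forall>C \<in> cells q m. measure \<mu> C = 1 / 3 ^ m)"


section \<open>Laplacian, derivatives at \<open>q 0\<close>, and Green's function\<close>

text \<open>
  Functions on the gasket are represented by functions on the plane of which only the values on
  \<open>gasket q\<close> matter. The graph Laplacian of level \<open>m\<close> exists only at the points of
  \<open>vertices q m\<close>. Hence uniform convergence on the union of all \<open>vertices q m\<close> without
  \<open>vertices q 0\<close> has to be read as: the error of level \<open>m\<close>, taken over the points of
  \<open>vertices q m - vertices q 0\<close>, tends to zero.
\<close>

definition graph_laplacian :: "(3 \<Rightarrow> real^2) \<Rightarrow> nat \<Rightarrow> (real^2 \<Rightarrow> real) \<Rightarrow> real^2 \<Rightarrow> real" where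
  "graph_laplacian q m u x = 3/2 * 5 ^ m * (\<Sum>y \<in> neighbours q m x. u y - u x)"

definition has_laplacian :: "(3 \<Rightarrow> real^2) \<Rightarrow> (real^2 \<Rightarrow> real) \<Rightarrow> (real^2 \<Rightarrow> real) \<Rightarrow> bool" where
  "has_laplacian q u f \<longleftrightarrow>
     continuous_on (gasket q) u \<and> continuous_on (gasket q) f \<and>
     (\<forall>e>0. \<exists>M. \<forall>m\<ge>M. \<forall>x \<in> vertices q m - vertices q 0. \<bar>graph_laplacian q m u x - f x\<bar> < e)"

primrec has_laplacian_pow ::
    "(3 \<Rightarrow> real^2) \<Rightarrow> nat \<Rightarrow> (real^2 \<Rightarrow> real) \<Rightarrow> (real^2 \<Rightarrow> real) \<Rightarrow> bool" where
  "has_laplacian_pow q 0 u f \<longleftrightarrow> continuous_on (gasket q) u \<and> (\<forall>x \<in> gasket q. f x = u x)"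
| "has_laplacian_pow q (Suc m) u f \<longleftrightarrow> (\<exists>g. has_laplacian_pow q m u g \<and> has_laplacian q g f)"

definition has_normal_deriv :: "(3 \<Rightarrow> real^2) \<Rightarrow> (real^2 \<Rightarrow> real) \<Rightarrow> real \<Rightarrow> bool" where
  "has_normal_deriv q u d \<longleftrightarrow>
     (\<lambda>m. (5/3) ^ m * (2 * u (q 0) - u ((contr q 0 ^^ m) (q 1)) - u ((contr q 0 ^^ m) (q 2))))
       \<longlonglongrightarrow> d"

definition has_tangential_deriv :: "(3 \<Rightarrow> real^2) \<Rightarrow> (real^2 \<Rightarrow> real) \<Rightarrow> real \<Rightarrow> bool" where
  "has_tangential_deriv q u d \<longleftrightarrow>
     (\<lambda>m. 5 ^ m * (u ((contr q 0 ^^ m) (q 1)) - u ((contr q 0 ^^ m) (q 2)))) \<longlonglongrightarrow> d"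

text \<open>\<open>solves_poisson q f u\<close>: \<open>u\<close> solves the Dirichlet problem for minus the Laplacian with data \<open>f\<close>.\<close>

definition solves_poisson :: "(3 \<Rightarrow> real^2) \<Rightarrow> (real^2 \<Rightarrow> real) \<Rightarrow> (real^2 \<Rightarrow> real) \<Rightarrow> bool" where
  "solves_poisson q f u \<longleftrightarrow> has_laplacian q u (\<lambda>x. - f x) \<and> (\<forall>x \<in> vertices q 0. u x = 0)"

definition green_op ::
    "(real^2) measure \<Rightarrow> (real^2 \<Rightarrow> real^2 \<Rightarrow> real) \<Rightarrow> (real^2 \<Rightarrow> real) \<Rightarrow> real^2 \<Rightarrow> real" where
  "green_op \<mu> G f x = (\<integral>y. G x y * f y \<partial>\<mu>)"

definition green_function ::
    "(3 \<Rightarrow> real^2) \<Rightarrow> (real^2) measure \<Rightarrow> (real^2 \<Rightarrow> real^2 \<Rightarrow> real) \<Rightarrow> bool" where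
  "green_function q \<mu> G \<longleftrightarrow>
     continuous_on (gasket q \<times> gasket q) (\<lambda>(x, y). G x y) \<and>
     (\<forall>x \<in> gasket q. \<forall>y \<in> gasket q. G x y = G y x) \<and>
     (\<forall>f. continuous_on (gasket q) f \<longrightarrow>
        solves_poisson q f (green_op \<mu> G f) \<and>
        (\<forall>u. solves_poisson q f u \<longrightarrow> (\<forall>x \<in> gasket q. u x = green_op \<mu> G f x)))"


section \<open>Antisymmetric monomials and orthogonal polynomials\<close>

definition antisym_jet :: "(3 \<Rightarrow> real^2) \<Rightarrow> nat \<Rightarrow> (real^2 \<Rightarrow> real) \<Rightarrow> bool" where
  "antisym_jet q j u \<longleftrightarrow>
     has_laplacian_pow q (Suc j) u (\<lambda>_. 0) \<and>
     (\<forall>m\<le>j. \<exists>f. has_laplacian_pow q m u f \<and> f (q 0) = 0 \<and> has_normal_deriv q f 0 \<and>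
        has_tangential_deriv q f (if m = j then 1 else 0))"

definition antisym_monomial :: "(3 \<Rightarrow> real^2) \<Rightarrow> nat \<Rightarrow> (real^2 \<Rightarrow> real) \<Rightarrow> bool" where
  "antisym_monomial q j P \<longleftrightarrow>
     antisym_jet q j P \<and> (\<forall>u. antisym_jet q j u \<longrightarrow> (\<forall>x \<in> gasket q. u x = P x))"

definition l2_inner :: "(real^2) measure \<Rightarrow> (real^2 \<Rightarrow> real) \<Rightarrow> (real^2 \<Rightarrow> real) \<Rightarrow> real" where
  "l2_inner \<mu> f g = (\<integral>x. f x * g x \<partial>\<mu>)"

definition l2_norm :: "(real^2) measure \<Rightarrow> (real^2 \<Rightarrow> real) \<Rightarrow> real" where
  "l2_norm \<mu> f = sqrt (l2_inner \<mu> f f)"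

text \<open>
  \<open>P\<close> is the sequence of monomials. The factor multiplying the inner product in \<open>gs_poly\<close> is the
  square of the number \<open>gs_d\<close> defined afterwards.
\<close>

fun gs_poly :: "(real^2) measure \<Rightarrow> (nat \<Rightarrow> real^2 \<Rightarrow> real) \<Rightarrow> nat \<Rightarrow> real^2 \<Rightarrow> real" where
  "gs_poly \<mu> P j =
     (\<lambda>x. P j x - (\<Sum>l<j. (inverse (l2_norm \<mu> (gs_poly \<mu> P l)))\<^sup>2 *
                            l2_inner \<mu> (P j) (gs_poly \<mu> P l) * gs_poly \<mu> P l x))"

declare gs_poly.simps [simp del]

definition gs_d :: "(real^2) measure \<Rightarrow> (nat \<Rightarrow> real^2 \<Rightarrow> real) \<Rightarrow> nat \<Rightarrow> real" where
  "gs_d \<mu> P k = inverse (l2_norm \<mu> (gs_poly \<mu> P k))"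

definition orthonormal_poly ::
    "(real^2) measure \<Rightarrow> (nat \<Rightarrow> real^2 \<Rightarrow> real) \<Rightarrow> nat \<Rightarrow> real^2 \<Rightarrow> real" where
  "orthonormal_poly \<mu> P k x = gs_d \<mu> P k * gs_poly \<mu> P k x"

text \<open>
  In the following two definitions the value at index \<open>0\<close> is not used in the recursion.
\<close>

primrec f_poly ::
    "(real^2) measure \<Rightarrow> (real^2 \<Rightarrow> real^2 \<Rightarrow> real) \<Rightarrow> (nat \<Rightarrow> real^2 \<Rightarrow> real) \<Rightarrow> nat \<Rightarrow> real^2 \<Rightarrow> real" where
  "f_poly \<mu> G P 0 = (\<lambda>x. 0)"
| "f_poly \<mu> G P (Suc k) = (\<lambda>x. - green_op \<mu> G (gs_poly \<mu> P k) x)"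

primrec f_tilde ::
    "(real^2) measure \<Rightarrow> (real^2 \<Rightarrow> real^2 \<Rightarrow> real) \<Rightarrow> (nat \<Rightarrow> real^2 \<Rightarrow> real) \<Rightarrow> nat \<Rightarrow> real^2 \<Rightarrow> real" where
  "f_tilde \<mu> G P 0 = (\<lambda>x. 0)"
| "f_tilde \<mu> G P (Suc k) = (\<lambda>x. - green_op \<mu> G (orthonormal_poly \<mu> P k) x)"

definition rec_b ::
    "(real^2) measure \<Rightarrow> (real^2 \<Rightarrow> real^2 \<Rightarrow> real) \<Rightarrow> (nat \<Rightarrow> real^2 \<Rightarrow> real) \<Rightarrow> nat \<Rightarrow> real" where
  "rec_b \<mu> G P k = (gs_d \<mu> P k)\<^sup>2 * l2_inner \<mu> (f_poly \<mu> G P (Suc k)) (gs_poly \<mu> P k)"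

text \<open>Only used for \<open>k \<ge> 1\<close>.\<close>

definition rec_c :: "(real^2) measure \<Rightarrow> (nat \<Rightarrow> real^2 \<Rightarrow> real) \<Rightarrow> nat \<Rightarrow> real" where
  "rec_c \<mu> P k = (gs_d \<mu> P (k - 1))\<^sup>2 / (gs_d \<mu> P k)\<^sup>2"


section \<open>Well-definedness of the gasket\<close>

lemma contr_alt: "contr q i x = (1/2) *\<^sub>R x + (1/2) *\<^sub>R q i"
  by (simp add: contr_def vec_eq_iff field_simps)

lemma dist_contr: "dist (contr q i x) (contr q i y) = dist x y / 2"
  by (simp add: contr_alt dist_norm flip: scaleR_diff_right)

lemma closure_contr: "closure (contr q i ` A) = contr q i ` closure A"
proof -
  have eq: "contr q i ` B = (\<lambda>x. (1/2) *\<^sub>R q i + x) ` ((*\<^sub>R) (1/2) ` B)" for B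
    by (auto simp: contr_alt image_image add.commute)
  show ?thesis
    unfolding eq closure_translation closure_scaleR ..
qed

lemma closure_UN_finite:
  assumes "finite I"
  shows "closure (\<Union>i\<in>I. A i) = (\<Union>i\<in>I. closure (A i))"
  using assms by (induction I rule: finite_induct) simp_all

lemma vertices_mono: "vertices q m \<subseteq> vertices q (Suc m)"
proof (induction m)
  case 0
  have "q i = contr q i (q i)" for i
    by (simp add: contr_def)
  then show ?case
    by fastforce
next
  case (Suc m)
  have "(\<Union>i. contr q i ` vertices q m) \<subseteq> (\<Union>i. contr q i ` vertices q (Suc m))"
    by (intro UN_mono image_mono order_refl Suc)
  then show ?case
    by (simp only: vertices.simps)
qed

lemma self_similar_subset:
  assumes A: "compact A" "A \<noteq> {}" "A = (\<Union>i. contr q i ` A)"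
    and B: "compact B" "B \<noteq> {}" "B = (\<Union>i. contr q i ` B)"
  shows "A \<subseteq> B"
proof -
  have "continuous_on A (\<lambda>x. infdist x B)"
    by (intro continuous_intros)
  from continuous_attains_sup[OF A(1,2) this]
  obtain a where a: "a \<in> A" "\<And>x. x \<in> A \<Longrightarrow> infdist x B \<le> infdist a B"
    by blast
  have "a \<in> (\<Union>i. contr q i ` A)"
    by (rule equalityD1[OF A(3), THEN subsetD, OF a(1)])
  then obtain i x where x: "x \<in> A" "a = contr q i x"
    by blast
  obtain b where b: "b \<in> B" "infdist x B = dist x b"
    using infdist_attains_inf[OF compact_imp_closed[OF B(1)] B(2)] by blast
  have "contr q i b \<in> B"
    by (rule equalityD2[OF B(3), THEN subsetD]) (use b(1) in blast)
  then have "infdist a B \<le> infdist x B / 2"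
    using infdist_le[of "contr q i b" B a] b(2) x(2) by (simp add: dist_contr)
  with a(2)[OF x(1)] have "infdist a B \<le> 0"
    by linarith
  then have "infdist y B = 0" if "y \<in> A" for y
    using a(2)[OF that] infdist_nonneg[of y B] by linarith
  then show ?thesis
    using in_closed_iff_infdist_zero[OF compact_imp_closed[OF B(1)] B(2)] by blast
qed

lemma gasket_unique_existence:
  "\<exists>!K. compact K \<and> K \<noteq> {} \<and> K = (\<Union>i. contr q i ` K)"
proof (rule ex_ex1I)
  let ?V = "\<Union>m. vertices q m"
  define R where "R = (\<Sum>i\<in>UNIV. norm (q i))"
  have R: "norm (q i) \<le> R" for i
    unfolding R_def by (rule member_le_sum) auto
  have "vertices q m \<subseteq> cball 0 R" for m
  proof (induction m)
    case 0
    then show ?case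
      using R by auto
  next
    case (Suc m)
    have "norm (contr q i x) \<le> R" if "x \<in> vertices q m" for i x
    proof -
      have "norm x \<le> R"
        using that Suc by auto
      then show ?thesis
        using R[of i] norm_triangle_ineq[of "(1/2) *\<^sub>R x" "(1/2) *\<^sub>R q i"]
        by (simp add: contr_alt)
    qed
    then show ?case
      by auto
  qed
  then have "bounded ?V"
    by (meson UN_least bounded_cball bounded_subset)
  then have "compact (closure ?V)"
    by (simp add: compact_closure)
  moreover have "closure ?V \<noteq> {}"
  proof -
    have "q 0 \<in> vertices q 0"
      by simp
    then show ?thesis
      using closure_subset by blast
  qed
  moreover have "closure ?V = (\<Union>i. contr q i ` closure ?V)"
  proof -
    have "?V = (\<Union>m. vertices q (Suc m))"
      using vertices_mono by blast
    also have "\<dots> = (\<Union>i. contr q i ` ?V)"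
      unfolding vertices.simps image_UN by (rule SUP_commute)
    finally have "?V = (\<Union>i. contr q i ` ?V)" .
    then have "closure ?V = closure (\<Union>i. contr q i ` ?V)"
      by (rule arg_cong)
    also have "\<dots> = (\<Union>i. closure (contr q i ` ?V))"
      by (rule closure_UN_finite) simp
    finally show ?thesis
      unfolding closure_contr .
  qed
  ultimately show "\<exists>K. compact K \<and> K \<noteq> {} \<and> K = (\<Union>i. contr q i ` K)"
    by (intro exI[of _ "closure ?V"] conjI)
next
  show "K = L" if "compact K \<and> K \<noteq> {} \<and> K = (\<Union>i. contr q i ` K)"
    and "compact L \<and> L \<noteq> {} \<and> L = (\<Union>i. contr q i ` L)" for K L
    by (rule equalityI; rule self_similar_subset[of _ q]; rule that[THEN conjunct1]
          that[THEN conjunct2, THEN conjunct1] that[THEN conjunct2, THEN conjunct2])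
qed

lemma gasket:
  shows compact_gasket: "compact (gasket q)"
    and gasket_nonempty: "gasket q \<noteq> {}"
    and gasket_self_similar: "gasket q = (\<Union>i. contr q i ` gasket q)"
proof -
  have *: "compact (gasket q) \<and> gasket q \<noteq> {} \<and> gasket q = (\<Union>i. contr q i ` gasket q)"
    unfolding gasket_def by (rule theI') (rule gasket_unique_existence)
  show "compact (gasket q)"
    by (rule *[THEN conjunct1])
  show "gasket q \<noteq> {}"
    by (rule *[THEN conjunct2, THEN conjunct1])
  show "gasket q = (\<Union>i. contr q i ` gasket q)"
    by (rule *[THEN conjunct2, THEN conjunct2])
qed

end

theory Submission
  imports Defs
begin

text \<open>
  Let \<open>A\<close> be minus the Green operator, so that \<open>A\<close> is a right inverse of the Laplacian and is
  symmetric in \<open>L\<^sup>2\<close>. Since the Laplacian maps \<open>P (Suc j)\<close> to \<open>P j\<close>, the function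
  \<open>A (P j) - P (Suc j)\<close> is harmonic; reflection symmetry makes it antisymmetric on the boundary, hence
  a multiple of \<open>P 0\<close>. So \<open>A p\<^sub>k\<close> is \<open>p\<^sub>k\<^sub>+\<^sub>1\<close> plus a combination of
  \<open>p\<^sub>0, \<dots>, p\<^sub>k\<close>, and by symmetry of \<open>A\<close> only the coefficients of \<open>p\<^sub>k\<close> and
  \<open>p\<^sub>k\<^sub>-\<^sub>1\<close> survive, as for orthogonal polynomials on the line.
\<close>

section \<open>Cells and vertices of the gasket\<close>

lemma funpow_contr: "(contr q i ^^ n) x = (1 / 2 ^ n) *\<^sub>R (x - q i) + q i"
  by (induction n) (simp_all add: contr_def)

lemma contr_in_gasket: "x \<in> gasket q \<Longrightarrow> contr q i x \<in> gasket q"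
  using gasket_self_similar[of q] by blast

lemma word_map_in_gasket: "x \<in> gasket q \<Longrightarrow> word_map q w x \<in> gasket q"
  by (induction w) (simp_all add: contr_in_gasket)

text \<open>Iterating \<open>contr q i\<close> from any point of the gasket stays in the gasket and
  converges to the fixed point \<open>q i\<close>; the gasket is closed.\<close>

lemma vertex_in_gasket: "q i \<in> gasket q"
proof -
  obtain y where y: "y \<in> gasket q"
    using gasket_nonempty by blast
  have "(contr q i ^^ n) y \<in> gasket q" for n
    by (induction n) (simp_all add: y contr_in_gasket)
  moreover have "(\<lambda>n. (contr q i ^^ n) y) \<longlonglongrightarrow> 0 *\<^sub>R (y - q i) + q i"
    unfolding funpow_contr
    by (intro tendsto_intros LIMSEQ_divide_realpow_zero) simp
  ultimately show ?thesis
    using closed_sequentially[OF compact_imp_closed[OF compact_gasket]] by fastforce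
qed

lemma vertices_subset_gasket: "vertices q m \<subseteq> gasket q"
  by (induction m) (auto simp: vertex_in_gasket contr_in_gasket)

lemma vertices_mono_le: "m \<le> n \<Longrightarrow> vertices q m \<subseteq> vertices q n"
  by (rule lift_Suc_mono_le[where f = "vertices q", OF vertices_mono])

lemma dist_word_map: "dist (word_map q w x) (word_map q w y) = dist x y / 2 ^ length w"
  by (induction w) (simp_all add: dist_contr)

lemma word_map_vertex: "word_map q w (q i) \<in> vertices q (length w)"
  by (induction w) auto

lemma in_some_cell:
  assumes "x \<in> gasket q"
  shows "\<exists>w. length w = m \<and> x \<in> word_map q w ` gasket q"
  using assms
proof (induction m arbitrary: x)
  case (Suc m)
  then obtain i y where y: "y \<in> gasket q" "x = contr q i y"
    using gasket_self_similar[of q] by blast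
  obtain w where "length w = m" "y \<in> word_map q w ` gasket q"
    using Suc.IH[OF y(1)] by blast
  then have "length (i # w) = Suc m" "x \<in> word_map q (i # w) ` gasket q"
    using y(2) by auto
  then show ?case
    by blast
qed simp

text \<open>Words of length \<open>m\<close> shrink distances by \<open>2 ^ m\<close> and the gasket
  is bounded, so cells of high level are arbitrarily small. This serves twice: to find vertices near
  a point, and to find sets of positive mass near a point.\<close>

lemma small_cell:
  assumes x: "x \<in> gasket q" and "0 < e"
  obtains w where "x \<in> word_map q w ` gasket q"
    "\<And>y z. \<lbrakk>y \<in> gasket q; z \<in> gasket q\<rbrakk> \<Longrightarrow> dist (word_map q w y) (word_map q w z) < e"
proof -
  obtain B where B: "\<And>y z. \<lbrakk>y \<in> gasket q; z \<in> gasket q\<rbrakk> \<Longrightarrow> dist y z \<le> B"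
    using compact_imp_bounded[OF compact_gasket] unfolding bounded_two_points by blast
  obtain m :: nat where m: "B / e < 2 ^ m"
    using real_arch_pow[of 2 "B / e"] by auto
  obtain w where w: "length w = m" "x \<in> word_map q w ` gasket q"
    using in_some_cell[OF x] by blast
  show ?thesis
  proof
    show "x \<in> word_map q w ` gasket q"
      by fact
    fix y z assume "y \<in> gasket q" "z \<in> gasket q"
    then have "dist y z \<le> B"
      by (rule B)
    also have "B < e * 2 ^ m"
      using m \<open>0 < e\<close> by (simp add: field_simps)
    finally show "dist (word_map q w y) (word_map q w z) < e"
      by (simp add: dist_word_map w(1) field_simps)
  qed
qed

lemma exhaust_type_3: "i = 0 \<or> i = 1 \<or> i = (2 :: 3)"
  using exhaust_3[of i] by auto

lemma equilateral_dist: "equilateral q \<Longrightarrow> i \<noteq> j \<Longrightarrow> dist (q i) (q j) = dist (q 0) (q 1)"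
  using exhaust_type_3[of i] exhaust_type_3[of j] unfolding equilateral_def
  by (metis dist_commute)

lemma equilateral_dist_pos: "equilateral q \<Longrightarrow> i \<noteq> j \<Longrightarrow> 0 < dist (q i) (q j)"
  by (subst equilateral_dist) (auto simp: equilateral_def)

text \<open>Take a cell around \<open>x\<close> of diameter below both \<open>e\<close> and the side
  length of the triangle. The images of \<open>q 0\<close> and \<open>q 1\<close> in it are distinct
  but closer than two boundary vertices can be, so at least one of them is not a boundary
  vertex.\<close>

lemma interior_vertices_dense:
  assumes q: "equilateral q" and x: "x \<in> gasket q" and "0 < e"
  obtains m y where "y \<in> vertices q m - vertices q 0" "dist y x < e"
proof -
  define d where "d = dist (q 0) (q 1)"
  have d: "0 < d"
    using equilateral_dist_pos[OF q, of 0 1] by (simp add: d_def)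
  obtain w where w: "x \<in> word_map q w ` gasket q"
    "\<And>y z. \<lbrakk>y \<in> gasket q; z \<in> gasket q\<rbrakk> \<Longrightarrow> dist (word_map q w y) (word_map q w z) < min e d"
    by (rule small_cell[OF x, of "min e d"]) (use d \<open>0 < e\<close> in auto)
  have close: "dist (word_map q w (q i)) x < e" for i
    using w(1) w(2)[OF vertex_in_gasket[of q i]] by auto
  have "dist (word_map q w (q 0)) (word_map q w (q 1)) < d"
    using w(2)[OF vertex_in_gasket[of q 0] vertex_in_gasket[of q 1]] by simp
  moreover have "word_map q w (q 0) \<noteq> word_map q w (q 1)"
    using d dist_word_map[of q w "q 0" "q 1"] by (auto simp: d_def)
  ultimately have "word_map q w (q 0) \<notin> vertices q 0 \<or> word_map q w (q 1) \<notin> vertices q 0"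
    using equilateral_dist[OF q] unfolding d_def vertices.simps by (metis less_irrefl rangeE)
  with close show ?thesis
    using that word_map_vertex by blast
qed


section \<open>The Laplacian\<close>

lemma has_laplacian_cong:
  assumes "has_laplacian q u f"
    and u: "\<And>x. x \<in> gasket q \<Longrightarrow> u x = u' x" and f: "\<And>x. x \<in> gasket q \<Longrightarrow> f x = f' x"
  shows "has_laplacian q u' f'"
proof -
  have "graph_laplacian q m u' x - f' x = graph_laplacian q m u x - f x"
    if "x \<in> vertices q m" for m x
  proof -
    have "x \<in> gasket q"
      using that vertices_subset_gasket by blast
    moreover have "y \<in> gasket q" if "y \<in> neighbours q m x" for y
      using that vertices_subset_gasket by (auto simp: neighbours_def)
    ultimately show ?thesis
      unfolding graph_laplacian_def by (simp add: u f)
  qed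
  moreover have "continuous_on (gasket q) u'" "continuous_on (gasket q) f'"
    using assms(1) continuous_on_cong[of "gasket q" "gasket q" u u']
      continuous_on_cong[of "gasket q" "gasket q" f f'] u f
    by (auto simp: has_laplacian_def)
  ultimately show ?thesis
    using assms(1) by (simp add: has_laplacian_def)
qed

lemma has_laplacian_add:
  assumes u: "has_laplacian q u f" and v: "has_laplacian q v g"
  shows "has_laplacian q (\<lambda>x. u x + v x) (\<lambda>x. f x + g x)"
  unfolding has_laplacian_def
proof (intro conjI allI impI)
  show "continuous_on (gasket q) (\<lambda>x. u x + v x)" "continuous_on (gasket q) (\<lambda>x. f x + g x)"
    using u v by (auto simp: has_laplacian_def intro!: continuous_intros)
  fix e :: real assume "0 < e"
  then have "0 < e / 2"
    by simp
  then obtain M N where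
    M: "\<And>m x. \<lbrakk>M \<le> m; x \<in> vertices q m - vertices q 0\<rbrakk> \<Longrightarrow> \<bar>graph_laplacian q m u x - f x\<bar> < e / 2" and
    N: "\<And>m x. \<lbrakk>N \<le> m; x \<in> vertices q m - vertices q 0\<rbrakk> \<Longrightarrow> \<bar>graph_laplacian q m v x - g x\<bar> < e / 2"
    using u v unfolding has_laplacian_def by meson
  have "graph_laplacian q m (\<lambda>x. u x + v x) x = graph_laplacian q m u x + graph_laplacian q m v x" for m x
    by (simp add: graph_laplacian_def add_diff_add sum.distrib distrib_left)
  then have "\<bar>graph_laplacian q m (\<lambda>x. u x + v x) x - (f x + g x)\<bar> < e"
    if "max M N \<le> m" "x \<in> vertices q m - vertices q 0" for m x
    using M[of m x] N[of m x] that unfolding abs_less_iff by simp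
  then show "\<exists>M. \<forall>m\<ge>M. \<forall>x\<in>vertices q m - vertices q 0.
      \<bar>graph_laplacian q m (\<lambda>x. u x + v x) x - (f x + g x)\<bar> < e"
    by blast
qed

lemma has_laplacian_cmult:
  assumes u: "has_laplacian q u f"
  shows "has_laplacian q (\<lambda>x. c * u x) (\<lambda>x. c * f x)"
  unfolding has_laplacian_def
proof (intro conjI allI impI)
  show "continuous_on (gasket q) (\<lambda>x. c * u x)" "continuous_on (gasket q) (\<lambda>x. c * f x)"
    using u by (auto simp: has_laplacian_def intro!: continuous_intros)
  fix e :: real assume "0 < e"
  \<comment> \<open>Adding 1 keeps the denominator positive when \<open>c = 0\<close>.\<close>
  then have "0 < e / (\<bar>c\<bar> + 1)"
    by simp
  then obtain M where
    M: "\<And>m x. \<lbrakk>M \<le> m; x \<in> vertices q m - vertices q 0\<rbrakk> \<Longrightarrow>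
          \<bar>graph_laplacian q m u x - f x\<bar> < e / (\<bar>c\<bar> + 1)"
    using u unfolding has_laplacian_def by meson
  have "\<bar>graph_laplacian q m (\<lambda>x. c * u x) x - c * f x\<bar> < e"
    if "M \<le> m" "x \<in> vertices q m - vertices q 0" for m x
  proof -
    have "graph_laplacian q m (\<lambda>x. c * u x) x - c * f x = c * (graph_laplacian q m u x - f x)"
      by (simp only: graph_laplacian_def sum_distrib_left right_diff_distrib mult.left_commute)
    then have "\<bar>graph_laplacian q m (\<lambda>x. c * u x) x - c * f x\<bar>
        \<le> (\<bar>c\<bar> + 1) * \<bar>graph_laplacian q m u x - f x\<bar>"
      by (simp add: abs_mult mult_right_mono)
    also have "\<dots> < (\<bar>c\<bar> + 1) * (e / (\<bar>c\<bar> + 1))"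
      using M[OF that] by (intro mult_strict_left_mono) simp_all
    finally show ?thesis
      by simp
  qed
  then show "\<exists>M. \<forall>m\<ge>M. \<forall>x\<in>vertices q m - vertices q 0.
      \<bar>graph_laplacian q m (\<lambda>x. c * u x) x - c * f x\<bar> < e"
    by blast
qed

lemma has_laplacian_diff:
  assumes "has_laplacian q u f" "has_laplacian q v g"
  shows "has_laplacian q (\<lambda>x. u x - v x) (\<lambda>x. f x - g x)"
  using has_laplacian_add[OF assms(1) has_laplacian_cmult[OF assms(2), of "-1"]] by simp

lemma has_laplacian_zero: "has_laplacian q (\<lambda>x. 0) (\<lambda>x. 0)"
  by (simp add: has_laplacian_def graph_laplacian_def)

lemma has_laplacian_sum:
  assumes "\<And>i. i \<in> I \<Longrightarrow> has_laplacian q (u i) (f i)"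
  shows "has_laplacian q (\<lambda>x. \<Sum>i\<in>I. u i x) (\<lambda>x. \<Sum>i\<in>I. f i x)"
  using assms
  by (induction I rule: infinite_finite_induct) (simp_all add: has_laplacian_zero has_laplacian_add)

text \<open>By linearity the zero function has Laplacian \<open>f - g\<close>. All its graph
  Laplacians vanish, which forces \<open>f = g\<close> at the interior vertices; these are dense and
  \<open>f - g\<close> is continuous, so the equality extends to the whole gasket, boundary
  included.\<close>

lemma has_laplacian_unique:
  assumes q: "equilateral q" and f: "has_laplacian q u f" and g: "has_laplacian q u g"
    and x: "x \<in> gasket q"
  shows "f x = g x"
proof (rule ccontr)
  assume "f x \<noteq> g x"
  have "has_laplacian q (\<lambda>x. 0) (\<lambda>x. f x - g x)"
    using has_laplacian_diff[OF f g] by simp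
  then have cont: "continuous_on (gasket q) (\<lambda>x. f x - g x)"
    and small: "\<And>e. e > 0 \<Longrightarrow> \<exists>M. \<forall>m\<ge>M. \<forall>x\<in>vertices q m - vertices q 0. \<bar>f x - g x\<bar> < e"
    by (auto simp: has_laplacian_def graph_laplacian_def abs_minus_commute)
  have eq: "f y = g y" if "y \<in> vertices q m - vertices q 0" for m y
  proof (rule ccontr)
    assume "f y \<noteq> g y"
    then obtain M where "\<And>n z. \<lbrakk>M \<le> n; z \<in> vertices q n - vertices q 0\<rbrakk> \<Longrightarrow> \<bar>f z - g z\<bar> < \<bar>f y - g y\<bar>"
      using small[of "\<bar>f y - g y\<bar>"] by auto
    \<comment> \<open>A vertex stays a vertex at all finer levels, so the estimate valid from level
      \<open>M\<close> on applies to \<open>y\<close> itself.\<close>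
    moreover have "y \<in> vertices q (max m M) - vertices q 0"
      using that vertices_mono_le[of m "max m M" q] by auto
    ultimately show False
      by (metis less_irrefl max.cobounded2)
  qed
  obtain e where e: "0 < e"
    "\<And>y. \<lbrakk>y \<in> gasket q; dist y x < e\<rbrakk> \<Longrightarrow> dist (f y - g y) (f x - g x) < \<bar>f x - g x\<bar>"
    using cont x \<open>f x \<noteq> g x\<close> unfolding continuous_on_iff by (metis right_minus_eq zero_less_abs_iff)
  obtain m y where y: "y \<in> vertices q m - vertices q 0" "dist y x < e"
    using interior_vertices_dense[OF q x e(1)] .
  then have "dist (f y - g y) (f x - g x) < \<bar>f x - g x\<bar>"
    using e(2) vertices_subset_gasket by blast
  with eq[OF y(1)] show False
    by (simp add: dist_real_def)
qed

section \<open>Iterated Laplacians and antisymmetric jets\<close>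

lemma has_laplacian_pow_cong:
  assumes "has_laplacian_pow q m u f" and "\<And>x. x \<in> gasket q \<Longrightarrow> u x = u' x"
  shows "has_laplacian_pow q m u' f"
  using assms(1)
proof (induction m arbitrary: f)
  case 0
  then show ?case
    using assms(2) continuous_on_cong[of "gasket q" "gasket q" u u'] by auto
qed auto

text \<open>The recursive definition exposes the last Laplacian applied; passing from the jet of
  \<open>u\<close> to the jet of its Laplacian requires exposing the first one.\<close>

lemma has_laplacian_pow_Suc_left:
  assumes "has_laplacian_pow q (Suc m) u f"
  shows "\<exists>g. has_laplacian q u g \<and> has_laplacian_pow q m g f"
  using assms
proof (induction m arbitrary: f)
  case 0
  then obtain g where "\<And>x. x \<in> gasket q \<Longrightarrow> g x = u x" "has_laplacian q g f"
    by auto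
  then have "has_laplacian q u f"
    by (auto intro: has_laplacian_cong)
  moreover from this have "has_laplacian_pow q 0 f f"
    by (simp add: has_laplacian_def)
  ultimately show ?case
    by blast
next
  case (Suc m)
  from Suc.prems obtain h where "has_laplacian_pow q (Suc m) u h" "has_laplacian q h f"
    by auto
  with Suc.IH obtain g where "has_laplacian q u g" "has_laplacian_pow q m g h"
    by blast
  with \<open>has_laplacian q h f\<close> show ?case
    by auto
qed

text \<open>The jet of the Laplacian of \<open>u\<close> is the jet of \<open>u\<close> shifted down
  by one order. With uniqueness of monomials this gives that the Laplacian maps each monomial to the
  preceding one.\<close>

lemma antisym_jet_laplacian:
  assumes q: "equilateral q" and u: "antisym_jet q (Suc j) u"
  shows "\<exists>g. has_laplacian q u g \<and> antisym_jet q j g"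
proof -
  obtain g where g: "has_laplacian q u g" "has_laplacian_pow q (Suc j) g (\<lambda>_. 0)"
    using has_laplacian_pow_Suc_left u unfolding antisym_jet_def by meson
  have "\<exists>f. has_laplacian_pow q m g f \<and> f (q 0) = 0 \<and> has_normal_deriv q f 0 \<and>
        has_tangential_deriv q f (if m = j then 1 else 0)" if "m \<le> j" for m
  proof -
    have "\<exists>f. has_laplacian_pow q (Suc m) u f \<and> f (q 0) = 0 \<and> has_normal_deriv q f 0 \<and>
        has_tangential_deriv q f (if m = j then 1 else 0)"
      using u[unfolded antisym_jet_def, THEN conjunct2, rule_format, of "Suc m"] that by simp
    then obtain f where f: "has_laplacian_pow q (Suc m) u f" "f (q 0) = 0" "has_normal_deriv q f 0"
        "has_tangential_deriv q f (if m = j then 1 else 0)"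
      by blast
    obtain g' where g': "has_laplacian q u g'" "has_laplacian_pow q m g' f"
      using has_laplacian_pow_Suc_left[OF f(1)] by blast
    \<comment> \<open>The first Laplacian \<open>g'\<close> obtained here may vary with
      \<open>m\<close>; uniqueness of the Laplacian identifies it with the fixed \<open>g\<close> on
      the gasket.\<close>
    have "has_laplacian_pow q m g f"
      using g'(2) has_laplacian_unique[OF q g'(1) g(1)] by (rule has_laplacian_pow_cong)
    with f show ?thesis
      by blast
  qed
  with g show ?thesis
    unfolding antisym_jet_def by blast
qed

lemma antisym_monomial_Suc:
  assumes "equilateral q" "antisym_monomial q (Suc j) P" "antisym_monomial q j P'"
  shows "has_laplacian q P P'"
proof -
  obtain g where g: "has_laplacian q P g" "antisym_jet q j g"
    using antisym_jet_laplacian assms(1,2) unfolding antisym_monomial_def by blast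
  show ?thesis
    using g(1) by (rule has_laplacian_cong) (use assms(3) g(2) in \<open>auto simp: antisym_monomial_def\<close>)
qed

lemma antisym_monomial_0:
  assumes "antisym_monomial q 0 P"
  shows "has_laplacian q P (\<lambda>_. 0)"
proof -
  have "has_laplacian_pow q (Suc 0) P (\<lambda>_. 0)"
    using assms unfolding antisym_monomial_def antisym_jet_def by blast
  then obtain g where g: "has_laplacian q P g" "has_laplacian_pow q 0 g (\<lambda>_. 0)"
    using has_laplacian_pow_Suc_left by meson
  show ?thesis
    using g(1) by (rule has_laplacian_cong) (use g(2) in auto)
qed

text \<open>A function vanishing on the gasket has tangential derivative 0 at \<open>q 0\<close>,
  whereas the jet prescribes 1.\<close>

lemma antisym_monomial_0_nonzero:
  assumes "antisym_monomial q 0 P"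
  shows "\<exists>x\<in>gasket q. P x \<noteq> 0"
proof (rule ccontr)
  assume "\<not> ?thesis"
  then have P: "P x = 0" if "x \<in> gasket q" for x
    using that by blast
  obtain f where f: "has_laplacian_pow q 0 P f" "has_tangential_deriv q f 1"
    using assms unfolding antisym_monomial_def antisym_jet_def by auto
  have "(contr q 0 ^^ m) (q i) \<in> gasket q" for m i
    by (induction m) (simp_all add: vertex_in_gasket contr_in_gasket)
  then have "f ((contr q 0 ^^ m) (q i)) = 0" for m i
    using f(1) P by simp
  then have "(\<lambda>m::nat. 0) \<longlonglongrightarrow> (1::real)"
    using f(2) by (simp add: has_tangential_deriv_def)
  then show False
    by (simp add: LIMSEQ_const_iff)
qed


section \<open>The reflection fixing the first vertex\<close>

text \<open>For a nondegenerate triangle, this is the orthogonal reflection in the line through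
  \<open>q 0\<close> perpendicular to the side from \<open>q 1\<close> to
  \<open>q 2\<close>.\<close>

definition reflection :: "(3 \<Rightarrow> real^2) \<Rightarrow> real^2 \<Rightarrow> real^2" where
  "reflection q x =
     x - (2 * ((x - q 0) \<bullet> (q 1 - q 2)) / ((q 1 - q 2) \<bullet> (q 1 - q 2))) *\<^sub>R (q 1 - q 2)"

text \<open>Negation modulo 3 fixes 0 and swaps 1 and 2, so it encodes how the reflection permutes
  the vertices.\<close>

lemma neg_type_3: "- (1::3) = 2" "- (2::3) = 1"
  by simp_all

lemma reflection_involution:
  assumes "equilateral q"
  shows "reflection q (reflection q x) = x"
proof -
  define v where "v = q 1 - q 2"
  have "v \<bullet> v \<noteq> 0"
    using equilateral_dist_pos[OF assms, of 1 2] by (simp add: v_def)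
  then have "(x - (2 * ((x - q 0) \<bullet> v) / (v \<bullet> v)) *\<^sub>R v - q 0) \<bullet> v = - ((x - q 0) \<bullet> v)"
    by (simp add: inner_diff_left)
  then show ?thesis
    by (simp add: reflection_def flip: v_def)
qed

lemma reflection_vertex:
  assumes q: "equilateral q"
  shows "reflection q (q i) = q (- i)"
proof -
  define v where "v = q 1 - q 2"
  have v: "v \<bullet> v \<noteq> 0"
    using equilateral_dist_pos[OF q, of 1 2] by (simp add: v_def)
  have "dist (q 1) (q 0) = dist (q 2) (q 0)"
    using equilateral_dist[OF q, of 1 0] equilateral_dist[OF q, of 2 0] by simp
  then have "(q 1 - q 0) \<bullet> (q 1 - q 0) = (q 2 - q 0) \<bullet> (q 2 - q 0)"
    by (simp add: dist_norm norm_eq_sqrt_inner)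
  \<comment> \<open>Since the sides at \<open>q 0\<close> are equally long, \<open>q 0\<close>
    projects to the midpoint of the opposite side; hence the reflection moves \<open>q 1\<close> and
    \<open>q 2\<close> by exactly one side vector.\<close>
  then have "2 * ((q 1 - q 0) \<bullet> v) = v \<bullet> v" "2 * ((q 2 - q 0) \<bullet> v) = - (v \<bullet> v)"
    by (simp_all add: v_def inner_diff_left inner_diff_right inner_commute)
  then have "reflection q (q 1) = q 1 - v" "reflection q (q 2) = q 2 + v" "reflection q (q 0) = q 0"
    using v by (simp_all add: reflection_def flip: v_def)
  then show ?thesis
    using exhaust_type_3[of i] by (auto simp: v_def neg_type_3)
qed

text \<open>The reflection is affine, so it preserves midpoints, and \<open>contr q i x\<close> is
  the midpoint of \<open>x\<close> and \<open>q i\<close>.\<close>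

lemma reflection_contr:
  assumes q: "equilateral q"
  shows "reflection q (contr q i x) = contr q (- i) (reflection q x)"
proof -
  have "reflection q ((1/2) *\<^sub>R x + (1/2) *\<^sub>R y) = (1/2) *\<^sub>R reflection q x + (1/2) *\<^sub>R reflection q y" for x y
  proof -
    define v where "v = q 1 - q 2"
    define w where "w = v \<bullet> v"
    have "((1/2) *\<^sub>R x + (1/2) *\<^sub>R y - q 0) \<bullet> v = ((x - q 0) \<bullet> v) / 2 + ((y - q 0) \<bullet> v) / 2"
      by (simp add: inner_add_left inner_diff_left field_simps)
    then show ?thesis
      by (simp add: reflection_def add_divide_distrib scaleR_add_left scaleR_diff_right flip: v_def w_def)
  qed
  then show ?thesis
    unfolding contr_alt by (simp add: reflection_vertex[OF q])
qed

lemma continuous_on_reflection: "continuous_on A (reflection q)"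
  unfolding reflection_def divide_inverse by (intro continuous_intros)

text \<open>Negation permutes the three indices, so the reflected gasket satisfies the same
  self-similarity equation; that equation has only one nonempty compact solution.\<close>

lemma reflection_gasket:
  assumes q: "equilateral q"
  shows "reflection q ` gasket q = gasket q"
proof -
  let ?K = "reflection q ` gasket q"
  have "compact ?K"
    by (intro compact_continuous_image continuous_on_reflection compact_gasket)
  moreover have "?K \<noteq> {}"
    using gasket_nonempty by simp
  moreover have "?K = (\<Union>i. contr q i ` ?K)"
  proof -
    have "?K = (\<Union>i. reflection q ` contr q i ` gasket q)"
      by (subst gasket_self_similar) (simp add: image_UN)
    also have "\<dots> = (\<Union>i\<in>range uminus. contr q i ` ?K)"
      by (simp only: image_image reflection_contr[OF q])
    also have "range uminus = (UNIV :: 3 set)"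
      by (rule surj_uminus)
    finally show ?thesis .
  qed
  ultimately show ?thesis
    using self_similar_subset[of ?K q "gasket q"] self_similar_subset[of "gasket q" q ?K]
      compact_gasket[of q] gasket_nonempty[of q] gasket_self_similar[of q]
    by (intro equalityI) assumption+
qed

lemma reflection_in_gasket: "equilateral q \<Longrightarrow> x \<in> gasket q \<Longrightarrow> reflection q x \<in> gasket q"
  using reflection_gasket by blast

lemma reflection_in_vertices:
  assumes q: "equilateral q"
  shows "x \<in> vertices q m \<Longrightarrow> reflection q x \<in> vertices q m"
  by (induction m arbitrary: x) (auto simp: reflection_vertex[OF q] reflection_contr[OF q], blast)

lemma reflection_in_cells:
  assumes q: "equilateral q" and "C \<in> cells q m"
  shows "reflection q ` C \<in> cells q m"
proof -
  \<comment> \<open>Moving the reflection inwards negates every letter, so cells go to cells of the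
    same level.\<close>
  have *: "reflection q (word_map q w x) = word_map q (map uminus w) (reflection q x)" for w x
    by (induction w) (simp_all add: reflection_contr[OF q])
  obtain w where w: "C = word_map q w ` gasket q" "length w = m"
    using assms(2) by (auto simp: cells_def)
  have "reflection q ` C = word_map q (map uminus w) ` reflection q ` gasket q"
    by (simp add: w image_image *)
  then show ?thesis
    using w(2) by (auto simp: cells_def reflection_gasket[OF q] intro!: exI[of _ "map uminus w"])
qed

lemma reflection_in_neighbours:
  assumes q: "equilateral q" and y: "y \<in> neighbours q m x"
  shows "reflection q y \<in> neighbours q m (reflection q x)"
proof -
  obtain C where C: "C \<in> cells q m" "x \<in> C" "y \<in> C"
    using y by (auto simp: neighbours_def)
  have "reflection q y \<noteq> reflection q x"
    using y reflection_involution[OF q] by (metis (mono_tags, lifting) mem_Collect_eq neighbours_def)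
  with y C show ?thesis
    using reflection_in_vertices[OF q] reflection_in_cells[OF q C(1)] by (auto simp: neighbours_def)
qed

text \<open>The reflection is an involution preserving adjacency, hence a bijection between the
  neighbours of \<open>x\<close> and those of its mirror image.\<close>

lemma graph_laplacian_reflection:
  assumes q: "equilateral q"
  shows "graph_laplacian q m (\<lambda>x. u (reflection q x)) x = graph_laplacian q m u (reflection q x)"
proof -
  have "(\<Sum>y\<in>neighbours q m x. u (reflection q y) - u (reflection q x)) =
        (\<Sum>y\<in>neighbours q m (reflection q x). u y - u (reflection q x))"
    by (rule sum.reindex_bij_witness[of _ "reflection q" "reflection q"])
      (use reflection_in_neighbours[OF q, of _ m x] reflection_in_neighbours[OF q, of _ m "reflection q x"]
        in \<open>simp_all add: reflection_involution[OF q]\<close>)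
  then show ?thesis
    by (simp add: graph_laplacian_def)
qed

lemma continuous_on_comp_reflection:
  assumes "equilateral q" "continuous_on (gasket q) u"
  shows "continuous_on (gasket q) (\<lambda>x. u (reflection q x))"
  by (rule continuous_on_compose2[OF assms(2) continuous_on_reflection])
    (simp add: reflection_gasket[OF assms(1)])

lemma has_laplacian_reflection:
  assumes q: "equilateral q" and u: "has_laplacian q u f"
  shows "has_laplacian q (\<lambda>x. u (reflection q x)) (\<lambda>x. f (reflection q x))"
  unfolding has_laplacian_def
proof (intro conjI allI impI)
  show "continuous_on (gasket q) (\<lambda>x. u (reflection q x))" "continuous_on (gasket q) (\<lambda>x. f (reflection q x))"
    using u by (auto simp: has_laplacian_def intro: continuous_on_comp_reflection[OF q])
  fix e :: real assume "0 < e"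
  then obtain M where
    M: "\<And>m x. \<lbrakk>M \<le> m; x \<in> vertices q m - vertices q 0\<rbrakk> \<Longrightarrow> \<bar>graph_laplacian q m u x - f x\<bar> < e"
    using u unfolding has_laplacian_def by meson
  have "reflection q x \<in> vertices q m - vertices q 0" if "x \<in> vertices q m - vertices q 0" for m x
    using that reflection_in_vertices[OF q] reflection_involution[OF q] by (metis DiffD1 DiffD2 DiffI)
  then show "\<exists>M. \<forall>m\<ge>M. \<forall>x\<in>vertices q m - vertices q 0.
      \<bar>graph_laplacian q m (\<lambda>x. u (reflection q x)) x - f (reflection q x)\<bar> < e"
    unfolding graph_laplacian_reflection[OF q] using M by blast
qed

lemma has_laplacian_pow_reflection:
  assumes q: "equilateral q" and u: "has_laplacian_pow q m u f"
  shows "has_laplacian_pow q m (\<lambda>x. - u (reflection q x)) (\<lambda>x. - f (reflection q x))"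
  using u
proof (induction m arbitrary: f)
  case 0
  then show ?case
    by (auto intro!: continuous_on_minus continuous_on_comp_reflection[OF q] reflection_in_gasket[OF q])
next
  case (Suc m)
  then obtain g where g: "has_laplacian_pow q m u g" "has_laplacian q g f"
    by auto
  have "has_laplacian q (\<lambda>x. - g (reflection q x)) (\<lambda>x. - f (reflection q x))"
    using has_laplacian_cmult[OF has_laplacian_reflection[OF q g(2)], of "-1"] by simp
  with Suc.IH[OF g(1)] show ?case
    by auto
qed

text \<open>Reflection swaps the two points in the difference quotients at \<open>q 0\<close>. The
  tangential quotient therefore changes sign, which the minus sign undoes; the normal derivative and
  the value only change sign, and they are 0.\<close>

lemma antisym_jet_reflection:
  assumes q: "equilateral q" and u: "antisym_jet q j u"
  shows "antisym_jet q j (\<lambda>x. - u (reflection q x))"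
proof -
  have pt: "reflection q ((contr q 0 ^^ m) (q i)) = (contr q 0 ^^ m) (q (- i))" for m i
    by (induction m) (simp_all add: reflection_vertex[OF q] reflection_contr[OF q])
  have "\<exists>f. has_laplacian_pow q m (\<lambda>x. - u (reflection q x)) f \<and> f (q 0) = 0 \<and> has_normal_deriv q f 0 \<and>
      has_tangential_deriv q f (if m = j then 1 else 0)" if m: "m \<le> j" for m
  proof -
    obtain f where f: "has_laplacian_pow q m u f" "f (q 0) = 0" "has_normal_deriv q f 0"
      "has_tangential_deriv q f (if m = j then 1 else 0)"
      using u m unfolding antisym_jet_def by blast
    let ?f = "\<lambda>x. - f (reflection q x)"
    have "has_normal_deriv q ?f 0"
      using tendsto_minus[OF f(3)[unfolded has_normal_deriv_def]]
      unfolding has_normal_deriv_def pt reflection_vertex[OF q] neg_type_3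
      by (simp add: algebra_simps)
    moreover have "has_tangential_deriv q ?f (if m = j then 1 else 0)"
      using f(4) unfolding has_tangential_deriv_def pt neg_type_3 by (simp add: algebra_simps)
    moreover have "?f (q 0) = 0"
      using f(2) by (simp add: reflection_vertex[OF q])
    ultimately show ?thesis
      using has_laplacian_pow_reflection[OF q f(1)] by (intro exI[of _ ?f]) simp
  qed
  moreover have "has_laplacian_pow q (Suc j) (\<lambda>x. - u (reflection q x)) (\<lambda>_. 0)"
    using has_laplacian_pow_reflection[OF q, of "Suc j" u "\<lambda>_. 0"] u unfolding antisym_jet_def by simp
  ultimately show ?thesis
    unfolding antisym_jet_def by blast
qed

text \<open>By uniqueness of the monomial, \<open>P\<close> equals minus its reflection on the
  gasket. Its values at the vertices are what the comparison of harmonic functions will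
  need.\<close>

lemma antisym_monomial_vertex:
  assumes q: "equilateral q" and P: "antisym_monomial q j P"
  shows "P (q (- i)) = - P (q i)"
proof -
  have "antisym_jet q j (\<lambda>x. - P (reflection q x))"
    using antisym_jet_reflection[OF q] P unfolding antisym_monomial_def by blast
  then have "- P (reflection q (q i)) = P (q i)"
    using P vertex_in_gasket unfolding antisym_monomial_def by blast
  then show ?thesis
    by (simp add: reflection_vertex[OF q])
qed


section \<open>Integration on the gasket\<close>

locale gasket_measure =
  fixes q :: "3 \<Rightarrow> real^2" and \<mu> :: "(real^2) measure"
  assumes standard: "standard_measure q \<mu>"
begin

sublocale prob_space \<mu>
  using standard by (simp add: standard_measure_def)

lemma sets_measure: "sets \<mu> = sets (restrict_space borel (gasket q))"
  using standard by (simp add: standard_measure_def)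

lemma space_measure: "space \<mu> = gasket q"
  using sets_eq_imp_space_eq[OF sets_measure] by (simp add: space_restrict_space)

lemma measure_cell: "C \<in> cells q m \<Longrightarrow> measure \<mu> C = 1 / 3 ^ m"
  using standard by (simp add: standard_measure_def)

lemma borel_measurable_continuous:
  fixes f :: "real^2 \<Rightarrow> real"
  assumes "continuous_on (gasket q) f"
  shows "f \<in> borel_measurable \<mu>"
  using borel_measurable_continuous_on_restrict[OF assms]
  by (simp add: measurable_cong_sets[OF sets_measure refl])

lemma integrable_continuous:
  fixes f :: "real^2 \<Rightarrow> real"
  assumes "continuous_on (gasket q) f"
  shows "integrable \<mu> f"
proof -
  have "bounded (f ` gasket q)"
    by (intro compact_imp_bounded compact_continuous_image assms compact_gasket)
  then obtain B where "\<And>x. x \<in> gasket q \<Longrightarrow> norm (f x) \<le> B"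
    by (auto simp: bounded_iff)
  then show ?thesis
    by (intro integrable_const_bound[where B = B] borel_measurable_continuous assms AE_I2)
      (simp add: space_measure)
qed

lemma integrable_pair_continuous:
  fixes F :: "(real^2) \<times> (real^2) \<Rightarrow> real"
  assumes F: "continuous_on (gasket q \<times> gasket q) F"
  shows "integrable (\<mu> \<Otimes>\<^sub>M \<mu>) F"
proof -
  interpret pair: pair_prob_space \<mu> \<mu> ..
  let ?K = "gasket q \<times> gasket q"
  have K: "compact ?K"
    by (intro compact_Times compact_gasket)
  \<comment> \<open>The sigma-algebra is the trace of the Borel sets on the gasket. Extending
    \<open>F\<close> by zero off the compact product gives a Borel function on the whole space,
    which is then pulled back along the identity in both coordinates.\<close>
  have "id \<in> measurable \<mu> borel"
    by (simp add: measurable_cong_sets[OF sets_measure refl] id_def measurable_restrict_space1)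
  then have "(\<lambda>p. (id (fst p), id (snd p))) \<in> measurable (\<mu> \<Otimes>\<^sub>M \<mu>) (borel \<Otimes>\<^sub>M borel)"
    by measurable
  moreover have "(\<lambda>p. indicator ?K p *\<^sub>R F p) \<in> borel_measurable (borel \<Otimes>\<^sub>M borel)"
    unfolding borel_prod
    by (intro borel_measurable_continuous_on_indicator borel_closed compact_imp_closed K F)
  ultimately have "(\<lambda>p. indicator ?K p *\<^sub>R F p) \<in> borel_measurable (\<mu> \<Otimes>\<^sub>M \<mu>)"
    by (auto dest: measurable_compose)
  then have "F \<in> borel_measurable (\<mu> \<Otimes>\<^sub>M \<mu>)"
    by (rule measurable_cong[THEN iffD1, rotated]) (simp add: space_pair_measure space_measure)
  moreover have "bounded (F ` ?K)"
    by (intro compact_imp_bounded compact_continuous_image F K)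
  then obtain B where "\<And>p. p \<in> ?K \<Longrightarrow> norm (F p) \<le> B"
    by (auto simp: bounded_iff)
  ultimately show ?thesis
    by (intro pair.integrable_const_bound[where B = B] AE_I2)
      (simp_all add: space_pair_measure space_measure)
qed

text \<open>A continuous function that is nonzero at \<open>x\<close> is nonzero on a whole small
  cell around \<open>x\<close>, and every cell has positive mass.\<close>

lemma continuous_eq_0_if_integral_square_eq_0:
  fixes f :: "real^2 \<Rightarrow> real"
  assumes f: "continuous_on (gasket q) f" and "(\<integral>x. f x * f x \<partial>\<mu>) = 0" and x: "x \<in> gasket q"
  shows "f x = 0"
proof (rule ccontr)
  assume "f x \<noteq> 0"
  have "integrable \<mu> (\<lambda>x. f x * f x)"
    by (intro integrable_continuous continuous_intros f)
  then have ae: "AE x in \<mu>. f x = 0"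
    using assms(2) integral_nonneg_eq_0_iff_AE[of \<mu> "\<lambda>x. f x * f x"] by simp
  obtain e where e: "0 < e" "\<And>y. \<lbrakk>y \<in> gasket q; dist y x < e\<rbrakk> \<Longrightarrow> dist (f y) (f x) < \<bar>f x\<bar>"
    using f x \<open>f x \<noteq> 0\<close> unfolding continuous_on_iff by (meson zero_less_abs_iff)
  obtain w where w: "x \<in> word_map q w ` gasket q"
    "\<And>y z. \<lbrakk>y \<in> gasket q; z \<in> gasket q\<rbrakk> \<Longrightarrow> dist (word_map q w y) (word_map q w z) < e"
    using small_cell[OF x e(1)] by blast
  define C where "C = word_map q w ` gasket q"
  have nz: "f y \<noteq> 0" if "y \<in> C" for y
  proof -
    have "dist y x < e" "y \<in> gasket q"
      using that w word_map_in_gasket by (auto simp: C_def)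
    then show ?thesis
      using e(2)[of y] by (auto simp: dist_real_def)
  qed
  have "measure \<mu> C = 1 / 3 ^ length w"
    by (rule measure_cell) (auto simp: C_def cells_def)
  then have C: "measure \<mu> C \<noteq> 0"
    by simp
  \<comment> \<open>Nonmeasurable sets have \<open>measure\<close> 0 by convention, so nonzero mass
    already implies measurability.\<close>
  then have "C \<in> sets \<mu>"
    using measure_notin_sets by blast
  moreover have "AE x in \<mu>. x \<notin> C"
    using ae by eventually_elim (use nz in blast)
  ultimately have "C \<in> null_sets \<mu>"
    by (simp add: AE_iff_null_sets)
  then show False
    using C by (auto simp: measure_def)
qed

section \<open>The inner product and self-adjointness of the Green operator\<close>

lemma l2_inner_commute: "l2_inner \<mu> f g = l2_inner \<mu> g f"
  by (simp add: l2_inner_def mult.commute)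

lemma l2_inner_cong:
  assumes "\<And>x. x \<in> gasket q \<Longrightarrow> f x = f' x" "\<And>x. x \<in> gasket q \<Longrightarrow> g x = g' x"
  shows "l2_inner \<mu> f g = l2_inner \<mu> f' g'"
  unfolding l2_inner_def using assms by (intro Bochner_Integration.integral_cong) (simp_all add: space_measure)

lemma l2_inner_diff_left:
  assumes "continuous_on (gasket q) f" "continuous_on (gasket q) g" "continuous_on (gasket q) h"
  shows "l2_inner \<mu> (\<lambda>x. f x - g x) h = l2_inner \<mu> f h - l2_inner \<mu> g h"
  unfolding l2_inner_def left_diff_distrib
  by (intro Bochner_Integration.integral_diff integrable_continuous continuous_intros assms)

lemma l2_inner_sum_left:
  assumes "\<And>i. i \<in> I \<Longrightarrow> continuous_on (gasket q) (f i)" "continuous_on (gasket q) h"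
  shows "l2_inner \<mu> (\<lambda>x. \<Sum>i\<in>I. c i * f i x) h = (\<Sum>i\<in>I. c i * l2_inner \<mu> (f i) h)"
proof -
  have "(\<integral>x. (\<Sum>i\<in>I. c i * (f i x * h x)) \<partial>\<mu>) = (\<Sum>i\<in>I. \<integral>x. c i * (f i x * h x) \<partial>\<mu>)"
    by (intro Bochner_Integration.integral_sum integrable_continuous continuous_intros assms)
  then show ?thesis
    by (simp add: l2_inner_def sum_distrib_right mult.assoc)
qed

lemma l2_inner_self_nonneg: "0 \<le> l2_inner \<mu> f f"
  by (simp add: l2_inner_def)

lemma l2_norm_square: "(l2_norm \<mu> f)\<^sup>2 = l2_inner \<mu> f f"
  by (simp add: l2_norm_def l2_inner_self_nonneg)

lemma l2_inner_self_eq_0D: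
  "continuous_on (gasket q) f \<Longrightarrow> l2_inner \<mu> f f = 0 \<Longrightarrow> x \<in> gasket q \<Longrightarrow> f x = 0"
  using continuous_eq_0_if_integral_square_eq_0 by (simp add: l2_inner_def)

text \<open>Fubini's theorem, applicable because the integrand is continuous on a compact product,
  combined with the symmetry of the kernel.\<close>

lemma green_op_symmetric:
  assumes G: "green_function q \<mu> G" and f: "continuous_on (gasket q) f" and g: "continuous_on (gasket q) g"
  shows "l2_inner \<mu> (green_op \<mu> G f) g = l2_inner \<mu> f (green_op \<mu> G g)"
proof -
  interpret pair_sigma_finite \<mu> \<mu> ..
  have cont: "continuous_on (gasket q \<times> gasket q) (\<lambda>(x, y). G x y)"
    and sym: "\<And>x y. \<lbrakk>x \<in> gasket q; y \<in> gasket q\<rbrakk> \<Longrightarrow> G x y = G y x"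
    using G by (auto simp: green_function_def)
  have "continuous_on (gasket q \<times> gasket q) (\<lambda>p. (\<lambda>(x, y). G x y) p * f (snd p) * g (fst p))"
    by (intro continuous_intros cont continuous_on_compose2[OF f] continuous_on_compose2[OF g]) auto
  then have "integrable (\<mu> \<Otimes>\<^sub>M \<mu>) (\<lambda>p. (\<lambda>(x, y). G x y) p * f (snd p) * g (fst p))"
    by (rule integrable_pair_continuous)
  then have int: "integrable (\<mu> \<Otimes>\<^sub>M \<mu>) (\<lambda>(x, y). G x y * f y * g x)"
    by (simp add: case_prod_unfold)
  have "l2_inner \<mu> (green_op \<mu> G f) g = (\<integral>x. (\<integral>y. G x y * f y * g x \<partial>\<mu>) \<partial>\<mu>)"
    by (simp add: l2_inner_def green_op_def)
  also have "\<dots> = (\<integral>y. (\<integral>x. G x y * f y * g x \<partial>\<mu>) \<partial>\<mu>)"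
    using Fubini_integral[OF int] by simp
  also have "\<dots> = (\<integral>y. (\<integral>x. f y * (G y x * g x) \<partial>\<mu>) \<partial>\<mu>)"
    by (intro Bochner_Integration.integral_cong) (simp_all add: space_measure sym)
  also have "\<dots> = l2_inner \<mu> f (green_op \<mu> G g)"
    by (simp add: l2_inner_def green_op_def)
  finally show ?thesis .
qed

end


section \<open>Antisymmetric polynomials\<close>

locale antisym_polynomials = gasket_measure +
  fixes G :: "real^2 \<Rightarrow> real^2 \<Rightarrow> real" and P :: "nat \<Rightarrow> real^2 \<Rightarrow> real"
  assumes equilateral: "equilateral q"
    and green: "green_function q \<mu> G"
    and monomial: "\<And>j. antisym_monomial q j (P j)"
begin

lemma laplacian_P_Suc: "has_laplacian q (P (Suc j)) (P j)"
  using equilateral monomial monomial by (rule antisym_monomial_Suc)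

lemma laplacian_P_0: "has_laplacian q (P 0) (\<lambda>_. 0)"
  using monomial by (rule antisym_monomial_0)

lemma continuous_P: "continuous_on (gasket q) (P j)"
  using laplacian_P_Suc by (simp add: has_laplacian_def)

lemma green_laplacian:
  "continuous_on (gasket q) f \<Longrightarrow> has_laplacian q (\<lambda>x. - green_op \<mu> G f x) f"
  using green has_laplacian_cmult[of q "green_op \<mu> G f" "\<lambda>x. - f x" "-1"]
  by (simp add: green_function_def solves_poisson_def)

lemma green_boundary: "continuous_on (gasket q) f \<Longrightarrow> green_op \<mu> G f (q i) = 0"
  using green by (simp add: green_function_def solves_poisson_def)

text \<open>The uniqueness clause for the Green function, with zero data, plays the part of the
  maximum principle.\<close>

lemma harmonic_eq_0:
  assumes "has_laplacian q u (\<lambda>_. 0)" and "\<And>i. u (q i) = 0" and x: "x \<in> gasket q"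
  shows "u x = 0"
proof -
  have "solves_poisson q (\<lambda>_. 0) u"
    using assms(1,2) by (auto simp: solves_poisson_def)
  then have "u x = green_op \<mu> G (\<lambda>_. 0) x"
    using green x by (simp add: green_function_def)
  then show ?thesis
    by (simp add: green_op_def)
qed

lemma P_first_vertex: "P j (q 0) = 0"
  using antisym_monomial_vertex[OF equilateral monomial, of j 0] by simp

text \<open>Otherwise antisymmetry makes the harmonic function \<open>P 0\<close> vanish at all
  three vertices, hence everywhere. The lemma makes division by \<open>P 0 (q 1)\<close>
  legitimate.\<close>

lemma P0_second_vertex: "P 0 (q 1) \<noteq> 0"
proof
  assume "P 0 (q 1) = 0"
  then have "P 0 (q i) = 0" for i
    using exhaust_type_3[of i] P_first_vertex
      antisym_monomial_vertex[OF equilateral monomial, of 0 1] by (auto simp: neg_type_3)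
  then have "P 0 x = 0" if "x \<in> gasket q" for x
    using harmonic_eq_0[OF laplacian_P_0] that by blast
  then show False
    using antisym_monomial_0_nonzero[OF monomial[of 0]] by blast
qed

text \<open>
  Without the last term, the difference of the two sides is harmonic and antisymmetric on the
  boundary; by uniqueness for the Dirichlet problem it is a multiple of \<open>P 0\<close>.
\<close>

lemma green_op_monomials:
  "\<exists>c. \<forall>x\<in>gasket q.
     - green_op \<mu> G (\<lambda>y. \<Sum>l\<le>n. a l * P l y) x = (\<Sum>l\<le>n. a l * P (Suc l) x) + c * P 0 x"
proof -
  define f where "f = (\<lambda>y. \<Sum>l\<le>n. a l * P l y)"
  define v where "v = (\<lambda>x. \<Sum>l\<le>n. a l * P (Suc l) x)"
  \<comment> \<open>The Green potential vanishes on the boundary, so this value makes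
    \<open>u\<close> vanish at \<open>q 1\<close>; antisymmetry then takes care of
    \<open>q 0\<close> and \<open>q 2\<close>.\<close>
  define c where "c = - v (q 1) / P 0 (q 1)"
  define u where "u = (\<lambda>x. - green_op \<mu> G f x - v x - c * P 0 x)"
  have f: "continuous_on (gasket q) f"
    unfolding f_def by (intro continuous_intros continuous_P)
  have "has_laplacian q v f"
    unfolding v_def f_def
    by (intro has_laplacian_sum has_laplacian_cmult laplacian_P_Suc)
  from has_laplacian_diff[OF has_laplacian_diff[OF green_laplacian[OF f] this]
      has_laplacian_cmult[OF laplacian_P_0], of c]
  have "has_laplacian q u (\<lambda>_. 0)"
    by (simp add: u_def)
  moreover have "u (q i) = 0" for i
  proof -
    have "v (q 0) = 0" "v (q 2) = - v (q 1)"
      using antisym_monomial_vertex[OF equilateral monomial, of _ 1]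
      by (simp_all add: v_def P_first_vertex neg_type_3 sum_negf)
    moreover have "P 0 (q 2) = - P 0 (q 1)"
      using antisym_monomial_vertex[OF equilateral monomial, of 0 1] by (simp add: neg_type_3)
    ultimately show ?thesis
      using exhaust_type_3[of i] P0_second_vertex
      by (auto simp: u_def green_boundary[OF f] P_first_vertex c_def)
  qed
  ultimately have "u x = 0" if "x \<in> gasket q" for x
    using harmonic_eq_0 that by blast
  then show ?thesis
    unfolding u_def f_def v_def by (intro exI[of _ c]) force
qed

text \<open>The Laplacian kills \<open>P 0\<close> and lowers all other indices by one. A
  combination vanishing on the gasket thus yields a shorter one with the same leading coefficient,
  until only a nonzero multiple of \<open>P 0\<close> is left.\<close>

lemma monomials_independent:
  assumes "a n \<noteq> 0"
  shows "\<exists>x\<in>gasket q. (\<Sum>l\<le>n. a l * P l x) \<noteq> 0"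
  using assms
proof (induction n arbitrary: a)
  case 0
  then show ?case
    using antisym_monomial_0_nonzero[OF monomial[of 0]] by simp
next
  case (Suc n)
  show ?case
  proof (rule ccontr)
    assume "\<not> ?thesis"
    then have zero: "(\<Sum>l\<le>Suc n. a l * P l x) = 0" if "x \<in> gasket q" for x
      using that by blast
    have "has_laplacian q (\<lambda>x. a 0 * P 0 x) (\<lambda>_. 0)"
      using has_laplacian_cmult[OF laplacian_P_0, of "a 0"] by simp
    moreover have "has_laplacian q (\<lambda>x. \<Sum>l\<le>n. a (Suc l) * P (Suc l) x) (\<lambda>x. \<Sum>l\<le>n. a (Suc l) * P l x)"
      by (intro has_laplacian_sum has_laplacian_cmult laplacian_P_Suc)
    ultimately have "has_laplacian q (\<lambda>x. \<Sum>l\<le>Suc n. a l * P l x) (\<lambda>x. \<Sum>l\<le>n. a (Suc l) * P l x)"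
      unfolding sum.atMost_Suc_shift using has_laplacian_add by fastforce
    then have "has_laplacian q (\<lambda>_. 0) (\<lambda>x. \<Sum>l\<le>n. a (Suc l) * P l x)"
      by (rule has_laplacian_cong) (simp_all add: zero del: sum.atMost_Suc)
    then have "(\<Sum>l\<le>n. a (Suc l) * P l x) = 0" if "x \<in> gasket q" for x
      using has_laplacian_unique[OF equilateral _ has_laplacian_zero that] by blast
    then show False
      using Suc.IH[of "\<lambda>l. a (Suc l)"] Suc.prems by blast
  qed
qed


section \<open>Orthogonal polynomials\<close>

abbreviation p :: "nat \<Rightarrow> real^2 \<Rightarrow> real" where
  "p \<equiv> gs_poly \<mu> P"

abbreviation d :: "nat \<Rightarrow> real" where
  "d \<equiv> gs_d \<mu> P"

lemma p_eq: "p j x = P j x - (\<Sum>l<j. (d l)\<^sup>2 * l2_inner \<mu> (P j) (p l) * p l x)"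
  by (subst gs_poly.simps) (simp add: gs_d_def)

lemma p_eq_sum_P: "\<exists>a. a n = 1 \<and> p n = (\<lambda>x. \<Sum>l\<le>n. a l * P l x)"
proof (induction n rule: less_induct)
  case (less n)
  then have "\<forall>m\<in>{..<n}. \<exists>a. p m = (\<lambda>x. \<Sum>l\<le>m. a l * P l x)"
    by auto
  then obtain a where "\<forall>m\<in>{..<n}. p m = (\<lambda>x. \<Sum>l\<le>m. a m l * P l x)"
    by (rule bchoice[THEN exE])
  then have a: "p m = (\<lambda>x. \<Sum>l\<le>m. a m l * P l x)" if "m < n" for m
    using that by simp
  define e where "e m = (d m)\<^sup>2 * l2_inner \<mu> (P n) (p m)" for m
  \<comment> \<open>Substituting the expansions of the earlier \<open>p m\<close> and exchanging the
    sums collects these coefficients of \<open>P l\<close>; zero padding makes both sums run over a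
    square.\<close>
  define b where "b l = (if l = n then 1 else - (\<Sum>m<n. if l \<le> m then e m * a m l else 0))" for l
  have "(\<Sum>m<n. e m * p m x) = (\<Sum>l<n. (\<Sum>m<n. if l \<le> m then e m * a m l else 0) * P l x)" for x
  proof -
    have "e m * p m x = (\<Sum>l<n. (if l \<le> m then e m * a m l else 0) * P l x)" if "m < n" for m
    proof -
      have "e m * p m x = (\<Sum>l\<le>m. e m * a m l * P l x)"
        by (simp add: a[OF that] sum_distrib_left mult.assoc)
      also have "\<dots> = (\<Sum>l<n. (if l \<le> m then e m * a m l else 0) * P l x)"
        using that by (intro sum.mono_neutral_cong_left) auto
      finally show ?thesis .
    qed
    then have "(\<Sum>m<n. e m * p m x) = (\<Sum>m<n. \<Sum>l<n. (if l \<le> m then e m * a m l else 0) * P l x)"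
      by simp
    also have "\<dots> = (\<Sum>l<n. \<Sum>m<n. (if l \<le> m then e m * a m l else 0) * P l x)"
      by (rule sum.swap)
    finally show ?thesis
      by (simp add: sum_distrib_right)
  qed
  moreover have "(\<Sum>l\<le>n. b l * P l x)
      = P n x - (\<Sum>l<n. (\<Sum>m<n. if l \<le> m then e m * a m l else 0) * P l x)" for x
    unfolding lessThan_Suc_atMost[symmetric] sum.lessThan_Suc by (simp add: b_def sum_negf)
  ultimately have "p n x = (\<Sum>l\<le>n. b l * P l x)" for x
    unfolding p_eq[of n] e_def[symmetric] by simp
  then show ?case
    by (intro exI[of _ b]) (auto simp: b_def)
qed

text \<open>The change of basis between monomials and orthogonal polynomials is triangular with unit
  diagonal, so inverting it keeps the leading coefficient.\<close>

lemma sum_P_eq_sum_p: "\<exists>b. b n = a n \<and> (\<forall>x. (\<Sum>l\<le>n. a l * P l x) = (\<Sum>l\<le>n. b l * p l x))"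
proof (induction n arbitrary: a)
  case 0
  then show ?case
    by (intro exI[of _ a]) (simp add: p_eq[of 0])
next
  case (Suc n)
  obtain b where b: "\<And>x. (\<Sum>l\<le>n. a l * P l x) = (\<Sum>l\<le>n. b l * p l x)"
    using Suc.IH[of a] by (elim exE conjE) simp
  define e where "e l = (d l)\<^sup>2 * l2_inner \<mu> (P (Suc n)) (p l)" for l
  define b' where "b' l = (if l = Suc n then a l else b l + a (Suc n) * e l)" for l
  have "P (Suc n) x = p (Suc n) x + (\<Sum>l\<le>n. e l * p l x)" for x
    using p_eq[of "Suc n" x] by (simp add: e_def lessThan_Suc_atMost)
  then have "(\<Sum>l\<le>Suc n. a l * P l x) = (\<Sum>l\<le>Suc n. b' l * p l x)" for x
    by (simp add: b b'_def distrib_left distrib_right sum.distrib sum_distrib_left mult.assoc)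
  then show ?case
    by (intro exI[of _ b']) (simp add: b'_def)
qed

lemma continuous_p: "continuous_on (gasket q) (p n)"
proof -
  obtain a where "p n = (\<lambda>x. \<Sum>l\<le>n. a l * P l x)"
    using p_eq_sum_P by blast
  then show ?thesis
    by (simp only:) (intro continuous_intros continuous_P)
qed

text \<open>Each \<open>p n\<close> has leading coefficient 1, so it is not identically zero on the
  gasket by independence. Hence no normalising factor \<open>d n\<close> is the degenerate inverse
  of 0.\<close>

lemma p_norm_pos: "0 < l2_inner \<mu> (p n) (p n)"
proof -
  obtain a where a: "a n = 1" "p n = (\<lambda>x. \<Sum>l\<le>n. a l * P l x)"
    using p_eq_sum_P by blast
  then obtain x where "x \<in> gasket q" "p n x \<noteq> 0"
    using monomials_independent[of a n] by auto
  then have "l2_inner \<mu> (p n) (p n) \<noteq> 0"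
    using l2_inner_self_eq_0D[OF continuous_p] by blast
  then show ?thesis
    using l2_inner_self_nonneg[of "p n"] by linarith
qed

lemma d_pos: "0 < d n"
  using p_norm_pos[of n] by (simp add: gs_d_def l2_norm_def)

lemma d_square: "(d n)\<^sup>2 = 1 / l2_inner \<mu> (p n) (p n)"
  by (simp add: gs_d_def power_divide l2_norm_square inverse_eq_divide)

lemma p_orthogonal_less: "i < j \<Longrightarrow> l2_inner \<mu> (p j) (p i) = 0"
proof (induction j arbitrary: i rule: less_induct)
  case (less j)
  define e where "e l = (d l)\<^sup>2 * l2_inner \<mu> (P j) (p l)" for l
  have orth: "l2_inner \<mu> (p l) (p i) = 0" if "l < j" "l \<noteq> i" for l
    using less that l2_inner_commute by (metis linorder_neqE_nat)
  have "l2_inner \<mu> (p j) (p i) = l2_inner \<mu> (\<lambda>x. P j x - (\<Sum>l<j. e l * p l x)) (p i)"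
    by (rule l2_inner_cong) (simp_all add: p_eq[of j] flip: e_def)
  also have "\<dots> = l2_inner \<mu> (P j) (p i) - (\<Sum>l<j. e l * l2_inner \<mu> (p l) (p i))"
    by (subst l2_inner_diff_left)
      (auto intro!: continuous_intros continuous_P continuous_p simp: l2_inner_sum_left continuous_p)
  \<comment> \<open>By induction only \<open>l = i\<close> contributes, and there the weight
    \<open>(d i)^2\<close> cancels the squared norm of \<open>p i\<close>.\<close>
  also have "(\<Sum>l<j. e l * l2_inner \<mu> (p l) (p i)) = (\<Sum>l\<in>{i}. e l * l2_inner \<mu> (p l) (p i))"
    using less.prems by (intro sum.mono_neutral_right) (auto simp: orth)
  also have "\<dots> = l2_inner \<mu> (P j) (p i)"
    using p_norm_pos[of i] by (simp add: e_def d_square)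
  finally show ?case
    by simp
qed

lemma p_orthogonal: "i \<noteq> j \<Longrightarrow> l2_inner \<mu> (p i) (p j) = 0"
  using p_orthogonal_less l2_inner_commute by (metis linorder_neqE_nat)

section \<open>The three-term recurrence\<close>

lemma f_poly_eq_sum_p:
  "\<exists>b. b (Suc k) = 1 \<and> (\<forall>x\<in>gasket q. f_poly \<mu> G P (Suc k) x = (\<Sum>l\<le>Suc k. b l * p l x))"
proof -
  obtain a where a: "a k = 1" "p k = (\<lambda>x. \<Sum>l\<le>k. a l * P l x)"
    using p_eq_sum_P by blast
  obtain c where c: "\<And>x. x \<in> gasket q \<Longrightarrow>
      - green_op \<mu> G (p k) x = (\<Sum>l\<le>k. a l * P (Suc l) x) + c * P 0 x"
    unfolding a(2) using green_op_monomials[of a k] by blast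
  \<comment> \<open>Inverting the Laplacian shifts the coefficients up by one, and the harmonic
    correction \<open>c\<close> fills slot 0; the leading coefficient remains
    \<open>a k = 1\<close>.\<close>
  define a' where "a' l = (case l of 0 \<Rightarrow> c | Suc m \<Rightarrow> a m)" for l
  obtain b where b: "b (Suc k) = a' (Suc k)" "\<And>x. (\<Sum>l\<le>Suc k. a' l * P l x) = (\<Sum>l\<le>Suc k. b l * p l x)"
    using sum_P_eq_sum_p[of "Suc k" a'] by blast
  have "f_poly \<mu> G P (Suc k) x = (\<Sum>l\<le>Suc k. a' l * P l x)" if "x \<in> gasket q" for x
    unfolding sum.atMost_Suc_shift using c[OF that] by (simp add: a'_def)
  then show ?thesis
    using b a(1) by (intro exI[of _ b]) (simp add: a'_def)
qed

text \<open>Both functions come from minus the Green operator, which is self-adjoint.\<close>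

lemma f_poly_symmetric:
  "l2_inner \<mu> (f_poly \<mu> G P (Suc k)) (p l) = l2_inner \<mu> (f_poly \<mu> G P (Suc l)) (p k)"
  using green_op_symmetric[OF green continuous_p[of k] continuous_p[of l]]
    l2_inner_commute[of "p k" "green_op \<mu> G (p l)"]
  by (simp add: l2_inner_def)

lemma f_poly_inner_p:
  assumes "\<forall>x\<in>gasket q. f_poly \<mu> G P (Suc k) x = (\<Sum>l\<le>Suc k. b l * p l x)"
  shows "l2_inner \<mu> (f_poly \<mu> G P (Suc k)) (p l) = (if l \<le> Suc k then b l * l2_inner \<mu> (p l) (p l) else 0)"
proof -
  have "l2_inner \<mu> (f_poly \<mu> G P (Suc k)) (p l) = l2_inner \<mu> (\<lambda>x. \<Sum>i\<le>Suc k. b i * p i x) (p l)"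
    using assms by (intro l2_inner_cong) auto
  also have "\<dots> = (\<Sum>i\<le>Suc k. b i * l2_inner \<mu> (p i) (p l))"
    by (intro l2_inner_sum_left continuous_p)
  also have "\<dots> = (\<Sum>i\<le>Suc k. if i = l then b l * l2_inner \<mu> (p l) (p l) else 0)"
    by (intro sum.cong) (auto simp: p_orthogonal)
  finally show ?thesis
    by (simp del: sum.atMost_Suc)
qed

lemma monic_recurrence:
  assumes x: "x \<in> gasket q"
  shows "f_poly \<mu> G P (Suc k) x =
    p (Suc k) x + rec_b \<mu> G P k * p k x + (if k = 0 then 0 else rec_c \<mu> P k * p (k - 1) x)"
proof -
  obtain b where b1: "b (Suc k) = 1"
    and b: "\<forall>x\<in>gasket q. f_poly \<mu> G P (Suc k) x = (\<Sum>l\<le>Suc k. b l * p l x)"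
    using f_poly_eq_sum_p by blast
  \<comment> \<open>By symmetry \<open>b l\<close> times the squared norm of \<open>p l\<close> is
    the inner product of \<open>f_poly\<close> at \<open>Suc l\<close> with \<open>p k\<close>. That
    function involves only indices up to \<open>Suc l\<close>, so the product is 0 unless
    \<open>Suc l = k\<close>; then the leading coefficient 1 leaves the ratio of squared norms of
    \<open>p k\<close> and \<open>p l\<close>, which is \<open>rec_c\<close>.\<close>
  have b_low: "b l = (if Suc l = k then rec_c \<mu> P k else 0)" if "l < k" for l
  proof -
    obtain b' where b'1: "b' (Suc l) = 1"
      and b': "\<forall>x\<in>gasket q. f_poly \<mu> G P (Suc l) x = (\<Sum>i\<le>Suc l. b' i * p i x)"
      using f_poly_eq_sum_p by blast
    have "b l * l2_inner \<mu> (p l) (p l) = (if k \<le> Suc l then b' k * l2_inner \<mu> (p k) (p k) else 0)"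
      using f_poly_inner_p[OF b, of l] f_poly_inner_p[OF b', of k] f_poly_symmetric[of k l] that by simp
    then show ?thesis
      using that b'1 p_norm_pos[of l] by (auto simp: rec_c_def d_square field_simps)
  qed
  have b_mid: "b k = rec_b \<mu> G P k"
    using f_poly_inner_p[OF b, of k] p_norm_pos[of k] by (simp add: rec_b_def d_square)
  have "(\<Sum>l<k. b l * p l x) = (\<Sum>l<k. if Suc l = k then rec_c \<mu> P k * p l x else 0)"
    by (intro sum.cong) (auto simp: b_low)
  \<comment> \<open>For \<open>k = 0\<close> the sum is empty, in accordance with the convention
    that the polynomial of index -1 is zero.\<close>
  also have "\<dots> = (if k = 0 then 0 else rec_c \<mu> P k * p (k - 1) x)"
    by (cases k) simp_all
  finally have low: "(\<Sum>l<k. b l * p l x) = (if k = 0 then 0 else rec_c \<mu> P k * p (k - 1) x)" .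
  have "f_poly \<mu> G P (Suc k) x = p (Suc k) x + rec_b \<mu> G P k * p k x + (\<Sum>l<k. b l * p l x)"
    using b x by (simp add: b1 b_mid flip: lessThan_Suc_atMost)
  then show ?thesis
    by (simp add: low)
qed

lemma rec_c_eq: "rec_c \<mu> P k = (d (k - 1) / d k)\<^sup>2"
  by (simp add: rec_c_def power_divide)

lemma sqrt_rec_c: "sqrt (rec_c \<mu> P k) = d (k - 1) / d k"
  using d_pos[of k] d_pos[of "k - 1"] by (simp add: rec_c_eq)

text \<open>Multiply the monic recurrence by \<open>d k\<close>. As the square root of
  \<open>rec_c\<close> at \<open>k\<close> is \<open>d (k - 1) / d k\<close>, the outer factors
  become \<open>d k = sqrt c_(k+1) * d (k + 1)\<close> and, for \<open>k > 0\<close>,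
  \<open>d k * c_k = sqrt c_k * d (k - 1)\<close>.\<close>

lemma orthonormal_recurrence:
  assumes x: "x \<in> gasket q"
  shows "sqrt (rec_c \<mu> P (Suc k)) * orthonormal_poly \<mu> P (Suc k) x =
           f_tilde \<mu> G P (Suc k) x - rec_b \<mu> G P k * orthonormal_poly \<mu> P k x
           - (if k = 0 then 0 else sqrt (rec_c \<mu> P k) * orthonormal_poly \<mu> P (k - 1) x)"
proof -
  have "f_tilde \<mu> G P (Suc k) x = - (\<integral>y. d k * (G x y * p k y) \<partial>\<mu>)"
    by (simp only: f_tilde.simps green_op_def orthonormal_poly_def mult.left_commute[of _ "d k"])
  then have "f_tilde \<mu> G P (Suc k) x = d k * f_poly \<mu> G P (Suc k) x"
    by (simp add: green_op_def)
  also have "\<dots> = d k * p (Suc k) x + rec_b \<mu> G P k * (d k * p k x)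
      + (if k = 0 then 0 else d k * rec_c \<mu> P k * p (k - 1) x)"
    unfolding monic_recurrence[OF x] by (simp add: distrib_left)
  also have "d k * p (Suc k) x = sqrt (rec_c \<mu> P (Suc k)) * orthonormal_poly \<mu> P (Suc k) x"
    using d_pos[of "Suc k"] by (simp add: sqrt_rec_c orthonormal_poly_def)
  also have "d k * rec_c \<mu> P k * p (k - 1) x = sqrt (rec_c \<mu> P k) * orthonormal_poly \<mu> P (k - 1) x"
    using d_pos[of k] unfolding sqrt_rec_c
    by (simp add: rec_c_eq orthonormal_poly_def power2_eq_square)
  finally show ?thesis
    by (simp add: orthonormal_poly_def)
qed

end

theorem theorem3p3:
  fixes q :: "3 \<Rightarrow> real^2"
    and \<mu> :: "(real^2) measure"
    and G :: "real^2 \<Rightarrow> real^2 \<Rightarrow> real"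
    and P :: "nat \<Rightarrow> real^2 \<Rightarrow> real"
    and k :: nat
    and x :: "real^2"
  assumes "equilateral q"
    and "standard_measure q \<mu>"
    and "green_function q \<mu> G"
    and "\<And>j. antisym_monomial q j (P j)"
    and "x \<in> gasket q"
  shows "sqrt (rec_c \<mu> P (Suc k)) * orthonormal_poly \<mu> P (Suc k) x =
           f_tilde \<mu> G P (Suc k) x - rec_b \<mu> G P k * orthonormal_poly \<mu> P k x
           - (if k = 0 then 0 else sqrt (rec_c \<mu> P k) * orthonormal_poly \<mu> P (k - 1) x)"
proof -
  interpret antisym_polynomials q \<mu> G P
    by unfold_locales (fact assms)+
  show ?thesis
    using assms(5) by (rule orthonormal_recurrence)
qed

end
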